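(* Let $q\in\mathbb{C}$ with $0<|q|<1$ and fix a square root $q^{1/2}$. For every integer $n\ge0$ and every $a\in\mathbb{C}$, $$\sum_{k=0}^{\infty}\frac{q^{\binom{k+1}{2}}A_{q}(aq^{k-2n})}{(q;q)_{k}}=(-q;q)_\infty(aq^{1-2n};q^2)_\infty,$$ $$\sum_{k=0}^{\infty}\frac{q^{\binom{k}{2}}(-q^{3/2})^{k}A_{q}(-q^{k-n+1/2})}{(q;q)_{k}}=\frac{(q;q)_{n}}{q^{(n^{2}-n)/4}(q^{1/2};q^{1/2})_{n}},$$ $$\sum_{k=0}^{\infty}\frac{q^{k^{2}/2}(-1)^{k}A_{q}(-q^{k-n-1/2})}{(q;q)_{k}}=\frac{(-1)^{n}(q;q)_{n}}{q^{(n^{2}+n)/4}(q^{1/2};q^{1/2})_{n}}.$$ Moreover, for every $w\in\mathbb{C}$ for which no denominator on the right-hand side vanishes, $$A_{q}(w)=(wq;q)_{\infty}\sum_{n=0}^{\infty}\frac{q^{3n^{2}}(-w^{2})^{n}}{(q^{2},wq,wq^{2};q^{2})_{n}},$$ $$A_{q}(w)=(-wq^{1/2};q)_{\infty}\sum_{n=0}^{\infty}\frac{q^{n(3n-1)/4}(-w)^{n}}{(q^{1/2};q^{1/2})_{n}(-wq^{1/2};q)_{n}},$$ $$A_{q}(w)=(-wq^{3/2};q)_{\infty}\sum_{n=0}^{\infty}\frac{q^{n(3n+1)/4}(-w)^{n}}{(q^{1/2};q^{1/2})_{n}(-wq^{3/2};q)_{n}}.$$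
   Context: Notation: for a base $p$ with $|p|<1$, $(a;p)_\infty=\prod_{k\ge0}(1-ap^k)$, $(a;p)_n=\prod_{k=0}^{n-1}(1-ap^k)$, and $(a_1,\dots,a_r;p)_n=\prod_i (a_i;p)_n$. The Ramanujan function is $A_q(x)=\sum_{n=0}^\infty \frac{q^{n^2}}{(q;q)_n}(-x)^n$. All fractional powers of $q$ are integer powers of the fixed $q^{1/2}$, e.g. $q^{(n^2\pm n)/4}=(q^{1/2})^{n(n\pm1)/2}$ and $q^{n(3n\pm1)/4}=(q^{1/2})^{n(3n\pm1)/2}$.
   Formalization: The factor (-1)^n on the right-hand side of the third identity is removed: as printed the identity fails for every odd n (for 0<q<1 with positive root and n=1 the left side is positive, the printed right side negative). *)

theory Defs
  imports "HOL-Analysis.Analysis"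
begin

definition qpoch :: "complex \<Rightarrow> complex \<Rightarrow> nat \<Rightarrow> complex" where
  "qpoch a p n = (\<Prod>k<n. 1 - a * p ^ k)"

(* Meaningful for norm p < 1, where the product converges; a vanishing factor is allowed and
   gives the value 0. *)
definition qpoch_inf :: "complex \<Rightarrow> complex \<Rightarrow> complex" where
  "qpoch_inf a p = (\<Prod>k. 1 - a * p ^ k)"

(* The Ramanujan function A_q(x); for 0 < norm q < 1 the series converges for every x. *)
definition ramanujan_A :: "complex \<Rightarrow> complex \<Rightarrow> complex" where
  "ramanujan_A q x = (\<Sum>n. q ^ (n ^ 2) / qpoch q q n * (- x) ^ n)"

(* Conventions for the identities about these functions: s is the fixed square root q^(1/2), and
   a fractional power q^(m/2) is written s ^ m or s powi m.  All exponents are exact: the numbers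
   halved by div are even, and truncated subtraction in n * (n - 1) and n * (3 * n - 1) is
   harmless because the first factor is 0 when n = 0.

   The third of the series over k sums to
     (q;q)_n / (q^((n^2+n)/4) (q^(1/2);q^(1/2))_n),
   without the factor (-1)^n with which it has been stated.  That factor cannot be right: by
   Euler's expansion of (z;q)_inf the left-hand side equals
     (s;q)_inf * sum_m s^(2m^2-(2n+1)m) / (s;s)_(2m),
   which is positive for 0 < s < 1. *)

end

theory Submission
  imports Defs "HOL-Computational_Algebra.Formal_Power_Series"
begin

text \<open>
  Everything rests on Euler's expansion
  $(z;p)_\<infinity> = \<Sum>_n p^{n(n-1)/2} (-z)^n / (p;p)_n$ (\<open>euler_sums\<close>) and on absolutely summable double
  series of the form $\<Sum>_{i,j} \<beta>_i \<alpha>_j q^{ij}$ (\<open>gaussian_double_sums\<close>).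

  For the three series over $k$, the coefficients in $k$ are those of Euler's series at some $z$, and
  shifting the argument of $A_q$ by $q^k$ contributes the kernel $q^{km}$ to the term of index $m$ of
  $A_q$.  Interchanging the summations (\<open>ramanujan_transform\<close>) yields a single series
  $\<Sum>_m q^{m^2} (-b)^m (zq^m;q)_\<infinity> / (q;q)_m$.  For $z = -q$ this is Euler's series in base $q^2$.
  For $z = s^3$ and $z = s$, where $s^2 = q$, it is a multiple of the odd, respectively even, part of
  Euler's series in base $s$ at $s^{-n}$.  Since $(s^{-n};s)_\<infinity> = 0$, these two parts coincide and equal
  half of $(-s^{-n};s)_\<infinity>$, and the infinite products disappear by Euler's identity
  $(s;s^2)_\<infinity> (-s;s)_\<infinity> = 1$.

  For the three expansions of $A_q(w)$, multiplying by the prefactor $(z;q)_\<infinity>$ turns the factor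
  $1/(z;q)_i$ into $(zq^i;q)_\<infinity>$.  Expanding the latter by Euler and collecting powers
  of $w$ (\<open>ramanujan_expansion\<close>) reduces each claim to a finite convolution identity.  The
  quadratic exponents are such that these convolutions are coefficients in the product identities
  \[ \frac{(-X;s)_\<infinity>}{(-X;s^2)_\<infinity>} = (-sX;s^2)_\<infinity>, \qquad
     \frac{(-X;s)_\<infinity>}{(-sX;s^2)_\<infinity>} = (-X;s^2)_\<infinity>, \qquad
     \frac{(X^2;q^2)_\<infinity>}{(X;q)_\<infinity>} = (-X;q)_\<infinity> \]
  of formal power series.  These hold because both sides have constant term $1$ and satisfy the
  same equation $F(X) = (1 - cX) F(qX)$ for some $c$, which has only one such solution (\<open>euler_fps_unique\<close>).
\<close>

section \<open>Finite and infinite $q$-shifted factorials\<close>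

lemma qpoch_0 [simp]: "qpoch a p 0 = 1"
  by (simp add: qpoch_def)

lemma qpoch_Suc: "qpoch a p (Suc n) = qpoch a p n * (1 - a * p ^ n)"
  by (simp add: qpoch_def)

lemma qpoch_Suc_left: "qpoch a p (Suc n) = (1 - a) * qpoch (a * p) p n"
  unfolding qpoch_def by (subst prod.lessThan_Suc_shift) (simp add: mult_ac)

lemma qpoch_bisect: "qpoch a p (2 * n) = qpoch a (p ^ 2) n * qpoch (a * p) (p ^ 2) n"
  by (induction n) (simp_all add: qpoch_Suc power_mult [symmetric] mult_ac)

lemma qpoch_minus: "qpoch a p n * qpoch (- a) p n = qpoch (a ^ 2) (p ^ 2) n"
proof -
  have "(1 - a * p ^ k) * (1 - (- a) * p ^ k) = 1 - a ^ 2 * (p ^ 2) ^ k" for k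
    by (simp add: algebra_simps power2_eq_square power_mult_distrib)
  then show ?thesis
    by (simp add: qpoch_def flip: prod.distrib)
qed

lemma power_neq_1:
  fixes p :: complex
  assumes "norm p < 1" and "n > 0"
  shows "p ^ n \<noteq> 1"
proof
  assume "p ^ n = 1"
  then have "norm p ^ n = 1"
    by (metis norm_one norm_power)
  then show False
    using assms power_Suc_less_one[of "norm p" "n - 1"]
    by (cases "norm p = 0") (auto simp: power_0_left)
qed

lemma qpoch_self_nonzero:
  assumes "norm p < 1"
  shows "qpoch p p n \<noteq> 0"
  using power_neq_1[OF assms, of "Suc k" for k] by (auto simp: qpoch_def)

lemma convergent_prod_qpoch:
  fixes a p :: complex
  assumes "norm p < 1"
  shows "convergent_prod (\<lambda>k. 1 - a * p ^ k)"
proof -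
  have "norm (1 - a * p ^ k - 1) = norm a * norm p ^ k" for k
    by (simp add: norm_mult norm_power)
  moreover have "summable (\<lambda>k. norm a * norm p ^ k)"
    using assms by (intro summable_mult summable_geometric) simp
  ultimately have "summable (\<lambda>k. norm (1 - a * p ^ k - 1))"
    by presburger
  then show ?thesis
    by (intro abs_convergent_prod_imp_convergent_prod summable_imp_abs_convergent_prod)
qed

lemma qpoch_tendsto:
  assumes "norm p < 1"
  shows "qpoch a p \<longlonglongrightarrow> qpoch_inf a p"
proof -
  have "(\<lambda>n. \<Prod>k\<le>n. 1 - a * p ^ k) \<longlonglongrightarrow> qpoch_inf a p"
    unfolding qpoch_inf_def by (rule convergent_prod_LIMSEQ[OF convergent_prod_qpoch[OF assms]])
  then have "(\<lambda>n. qpoch a p (Suc n)) \<longlonglongrightarrow> qpoch_inf a p"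
    by (simp add: qpoch_def lessThan_Suc_atMost)
  then show ?thesis
    by (simp only: filterlim_sequentially_Suc)
qed

lemma qpoch_inf_split:
  assumes "norm p < 1"
  shows "qpoch_inf a p = qpoch a p n * qpoch_inf (a * p ^ n) p"
proof -
  have "qpoch a p (m + n) = qpoch a p n * qpoch (a * p ^ n) p m" for m
    by (induction m) (simp_all add: qpoch_Suc power_add mult_ac)
  then have "(\<lambda>m. qpoch a p (m + n)) \<longlonglongrightarrow> qpoch a p n * qpoch_inf (a * p ^ n) p"
    using tendsto_mult_left[OF qpoch_tendsto[OF assms, of "a * p ^ n"]] by simp
  moreover have "(\<lambda>m. qpoch a p (m + n)) \<longlonglongrightarrow> qpoch_inf a p"
    using qpoch_tendsto[OF assms] by (rule LIMSEQ_ignore_initial_segment)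
  ultimately show ?thesis
    by (rule LIMSEQ_unique[symmetric])
qed

lemma qpoch_inf_nonzero:
  assumes "norm p < 1" and "\<And>n. qpoch a p n \<noteq> 0"
  shows "qpoch_inf a p \<noteq> 0"
proof -
  have "1 - a * p ^ k \<noteq> 0" for k
    using assms(2)[of "Suc k"] by (simp add: qpoch_Suc)
  then show ?thesis
    unfolding qpoch_inf_def by (rule prodinf_nonzero[OF convergent_prod_qpoch[OF assms(1)]])
qed

text \<open>
  Euler's identity behind "partitions into odd parts are partitions into distinct parts":
  $(p;p^2)_\<infinity> (-p;p)_\<infinity> = 1$.  Splitting $(p;p)_\<infinity>$ by the parity of the exponent gives
  $(p;p^2)_\<infinity> (p^2;p^2)_\<infinity>$, while $(p;p)_n (-p;p)_n = (p^2;p^2)_n$ gives in the limit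
  $(p;p)_\<infinity> (-p;p)_\<infinity> = (p^2;p^2)_\<infinity>$; the common factor cancels.
\<close>

lemma qpoch_inf_odd_mult_minus:
  assumes "norm p < 1"
  shows "qpoch_inf p (p ^ 2) * qpoch_inf (- p) p = 1"
proof -
  have p2: "norm (p ^ 2) < 1"
    using assms by (simp add: norm_power power_less_one_iff)
  have "(\<lambda>n. qpoch p p (2 * n)) \<longlonglongrightarrow> qpoch_inf p p"
    using LIMSEQ_subseq_LIMSEQ[OF qpoch_tendsto[OF assms], of "\<lambda>n. 2 * n"]
    by (simp add: o_def strict_mono_def)
  moreover have "(\<lambda>n. qpoch p p (2 * n)) \<longlonglongrightarrow> qpoch_inf p (p ^ 2) * qpoch_inf (p ^ 2) (p ^ 2)"
    unfolding qpoch_bisect using tendsto_mult[OF qpoch_tendsto[OF p2] qpoch_tendsto[OF p2]]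
    by (simp add: power2_eq_square)
  ultimately have 1: "qpoch_inf p p = qpoch_inf p (p ^ 2) * qpoch_inf (p ^ 2) (p ^ 2)"
    by (rule LIMSEQ_unique)
  have "(\<lambda>n. qpoch p p n * qpoch (- p) p n) \<longlonglongrightarrow> qpoch_inf p p * qpoch_inf (- p) p"
    by (intro tendsto_mult qpoch_tendsto assms)
  then have "qpoch (p ^ 2) (p ^ 2) \<longlonglongrightarrow> qpoch_inf p p * qpoch_inf (- p) p"
    by (simp add: qpoch_minus)
  then have "qpoch_inf p p * qpoch_inf (- p) p = qpoch_inf (p ^ 2) (p ^ 2)"
    using qpoch_tendsto[OF p2] by (rule LIMSEQ_unique)
  with 1 have "qpoch_inf (p ^ 2) (p ^ 2) * (qpoch_inf p (p ^ 2) * qpoch_inf (- p) p)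
      = qpoch_inf (p ^ 2) (p ^ 2) * 1"
    by (simp add: mult_ac)
  then show ?thesis
    using qpoch_inf_nonzero[OF p2 qpoch_self_nonzero[OF p2]] by simp
qed

section \<open>Euler's expansion of the infinite product\<close>

text \<open>
  The coefficient of $(-z)^n$ in the Taylor expansion of $(z;p)_\<infinity>$.
\<close>

definition euler_coeff :: "complex \<Rightarrow> nat \<Rightarrow> complex" where
  "euler_coeff p n = p ^ (n choose 2) / qpoch p p n"

lemma euler_coeff_0 [simp]: "euler_coeff p 0 = 1"
  by (simp add: euler_coeff_def numeral_2_eq_2)

text \<open>
  The quadratic exponents below are all rewritten as linear combinations of \<open>n choose 2\<close>, \<open>n\<close> and
  products, so that identities between them become linear.
\<close>

lemma choose_two_Suc: "Suc n choose 2 = (n choose 2) + n"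
  by (simp add: numeral_2_eq_2)

lemma choose_two_add: "(m + n) choose 2 = (m choose 2) + (n choose 2) + m * n"
  by (induction n) (simp_all add: choose_two_Suc)

lemma square_eq_choose_two: "n ^ 2 = 2 * (n choose 2) + n"
  by (induction n) (simp_all add: choose_two_Suc power2_eq_square)

lemma euler_coeff_Suc:
  "euler_coeff p (Suc n) = euler_coeff p n * (p ^ n / (1 - p ^ Suc n))"
  by (simp add: euler_coeff_def qpoch_Suc choose_two_Suc power_add)

lemma euler_coeff_rec:
  assumes "norm p < 1"
  shows "euler_coeff p (Suc n) * (1 - p ^ Suc n) = euler_coeff p n * p ^ n"
  using power_neq_1[OF assms, of "Suc n"] by (simp add: euler_coeff_Suc)

lemma summable_norm_euler:
  assumes "norm p < 1"
  shows "summable (\<lambda>n. norm (euler_coeff p n * z ^ n))"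
proof -
  have "(\<lambda>n. p ^ n / (1 - p ^ Suc n) * z) \<longlonglongrightarrow> 0 / (1 - 0) * z"
    by (intro tendsto_intros LIMSEQ_power_zero LIMSEQ_Suc assms) auto
  then have "(\<lambda>n. norm (p ^ n / (1 - p ^ Suc n) * z)) \<longlonglongrightarrow> 0"
    using tendsto_norm by fastforce
  then have "eventually (\<lambda>n. norm (p ^ n / (1 - p ^ Suc n) * z) < 1 / 2) sequentially"
    by (rule order_tendstoD) simp
  then obtain N where N: "norm (p ^ n / (1 - p ^ Suc n) * z) < 1 / 2" if "n \<ge> N" for n
    by (auto simp: eventually_sequentially)
  show ?thesis
  proof (rule summable_ratio_test[of "1 / 2" N])
    fix n assume "n \<ge> N"
    have "norm (norm (euler_coeff p (Suc n) * z ^ Suc n))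
        = norm (p ^ n / (1 - p ^ Suc n) * z) * norm (euler_coeff p n * z ^ n)"
      by (simp add: euler_coeff_Suc norm_mult norm_divide norm_power mult_ac)
    also have "\<dots> \<le> 1 / 2 * norm (euler_coeff p n * z ^ n)"
      using N[OF \<open>n \<ge> N\<close>] by (intro mult_right_mono) auto
    finally show "norm (norm (euler_coeff p (Suc n) * z ^ Suc n))
        \<le> 1 / 2 * norm (norm (euler_coeff p n * z ^ n))"
      by simp
  qed simp
qed

text \<open>
  The coefficient recurrence says that the entire function $f(z) = \<Sum>_n c_n z^n$ satisfies
  $f(z) = (1 + z) f(pz)$.  Iterating, $f(-z) = (z;p)_n f(-zp^n)$, and continuity of $f$ at
  $0$ with $f(0) = 1$ identifies the limit as the infinite product.
\<close>

theorem euler_sums: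
  assumes "norm p < 1"
  shows "(\<lambda>n. euler_coeff p n * (- z) ^ n) sums qpoch_inf z p"
proof -
  define f where "f z = (\<Sum>n. euler_coeff p n * z ^ n)" for z
  have sm: "summable (\<lambda>n. euler_coeff p n * z ^ n)" for z
    using summable_norm_euler[OF assms] by (rule summable_norm_cancel)
  have step: "f z = (1 + z) * f (p * z)" for z
  proof -
    have *: "(\<lambda>n. euler_coeff p n * (p * z) ^ n) sums f (p * z)"
      unfolding f_def by (rule summable_sums[OF sm])
    have "(\<lambda>n. if n = 0 then 0 else euler_coeff p (n - 1) * (p * z) ^ (n - 1) * z)
        sums (f (p * z) * z)"
      using sums_Suc[of "\<lambda>n. if n = 0 then 0 else euler_coeff p (n - 1) * (p * z) ^ (n - 1) * z"]
        sums_mult2[OF *, of z] by simp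
    from sums_add[OF * this] have "(\<lambda>n. euler_coeff p n * (p * z) ^ n
        + (if n = 0 then 0 else euler_coeff p (n - 1) * (p * z) ^ (n - 1) * z))
        sums (f (p * z) + f (p * z) * z)" .
    moreover have "euler_coeff p n * (p * z) ^ n
          + (if n = 0 then 0 else euler_coeff p (n - 1) * (p * z) ^ (n - 1) * z)
          = euler_coeff p n * z ^ n" for n
    proof (cases n)
      case (Suc m)
      have "euler_coeff p (Suc m) * (p * z) ^ Suc m + (euler_coeff p m * p ^ m) * z ^ Suc m
          = euler_coeff p (Suc m) * z ^ Suc m"
        unfolding euler_coeff_rec[OF assms, of m, symmetric]
        by (simp add: algebra_simps power_mult_distrib)
      then show ?thesis
        using Suc by (simp add: power_mult_distrib mult_ac)
    qed simp
    ultimately have "(\<lambda>n. euler_coeff p n * z ^ n) sums (f (p * z) + f (p * z) * z)"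
      by (simp only:)
    then show ?thesis
      using sums_unique by (fastforce simp: f_def algebra_simps)
  qed
  have iter: "f (- z) = qpoch z p n * f (- (z * p ^ n))" for n
  proof (induction n)
    case (Suc n)
    then show ?case
      using step[of "- (z * p ^ n)"] by (simp add: qpoch_Suc mult_ac)
  qed simp
  have "isCont f 0"
    unfolding f_def by (rule isCont_powser_converges_everywhere[OF sm])
  moreover have "(\<lambda>n. - (z * p ^ n)) \<longlonglongrightarrow> - (z * 0)"
    by (intro tendsto_intros LIMSEQ_power_zero assms)
  ultimately have "(\<lambda>n. f (- (z * p ^ n))) \<longlonglongrightarrow> f 0"
    using isCont_tendsto_compose by fastforce
  with qpoch_tendsto[OF assms] have "(\<lambda>n. qpoch z p n * f (- (z * p ^ n))) \<longlonglongrightarrow> qpoch_inf z p * f 0"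
    by (intro tendsto_mult)
  then have "f (- z) = qpoch_inf z p * f 0"
    using iter LIMSEQ_unique[of "\<lambda>_. f (- z)"] by (metis (no_types, lifting) ext tendsto_const)
  moreover have "f 0 = 1"
    using powser_zero[of "euler_coeff p"] by (simp add: f_def euler_coeff_def numeral_2_eq_2)
  ultimately show ?thesis
    using summable_sums[OF sm, of "- z"] by (simp add: f_def)
qed

section \<open>Double series with the kernel $q^{ij}$\<close>

lemma summable_norm_mult_bounded:
  fixes f g :: "nat \<Rightarrow> complex"
  assumes "summable (\<lambda>n. norm (f n))" and "\<And>n. norm (g n) \<le> 1"
  shows "summable (\<lambda>n. norm (f n * g n))"
  using assms by (intro summable_comparison_test'[OF assms(1)]) (simp add: norm_mult mult_left_le)

text \<open>
  The family $\<beta>_i \<alpha>_j q^{ij}$ is dominated by $|\<beta>_i| |\<alpha>_j|$, hence absolutely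
  summable, so its sums by columns, by rows and by antidiagonals agree.  Rows and columns
  give the transformation of series over shifted arguments; rows and antidiagonals give the power
  series expansions.
\<close>

lemma gaussian_double_sums:
  fixes \<alpha> \<beta> :: "nat \<Rightarrow> complex" and q :: complex
  assumes \<alpha>: "summable (\<lambda>j. norm (\<alpha> j))" and \<beta>: "summable (\<lambda>i. norm (\<beta> i))"
    and q: "norm q \<le> 1"
  obtains S where
    "(\<lambda>j. \<alpha> j * (\<Sum>i. \<beta> i * (q ^ j) ^ i)) sums S"
    "(\<lambda>i. \<beta> i * (\<Sum>j. \<alpha> j * (q ^ i) ^ j)) sums S"
    "(\<lambda>N. \<Sum>i\<le>N. \<beta> i * \<alpha> (N - i) * q ^ (i * (N - i))) sums S"
proof -
  define F where "F = (\<lambda>(i, j). \<beta> i * \<alpha> j * q ^ (i * j))"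
  have le: "norm (q ^ k) \<le> 1" for k
    using q by (simp add: norm_power power_le_one)
  have damped: "summable (\<lambda>j. norm (\<gamma> j * (q ^ i) ^ j))" if "summable (\<lambda>j. norm (\<gamma> j))"
    for \<gamma> :: "nat \<Rightarrow> complex" and i
    using le by (intro summable_norm_mult_bounded that) (simp flip: power_mult)
  have "(\<lambda>x. norm ((\<lambda>(i, j). \<beta> i * \<alpha> j) x)) summable_on (UNIV \<times> UNIV)"
  proof -
    have "(\<lambda>i. norm (\<beta> i)) summable_on UNIV" "(\<lambda>j. norm (\<alpha> j)) summable_on UNIV"
      using \<alpha> \<beta> by (simp_all add: norm_summable_imp_summable_on)
    then show ?thesis
      by (subst Infinite_Sum.abs_summable_on_Sigma_iff)
        (simp add: norm_mult summable_on_cmult_left summable_on_cmult_right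
          infsum_cmult_right' infsum_nonneg)
  qed
  then have "(\<lambda>x. norm (F x)) summable_on (UNIV \<times> UNIV)"
  proof (rule Infinite_Sum.abs_summable_on_comparison_test)
    fix x :: "nat \<times> nat"
    show "norm (F x) \<le> norm (case x of (i, j) \<Rightarrow> \<beta> i * \<alpha> j)"
      using le by (cases x) (simp add: F_def norm_mult mult_left_le)
  qed
  then have "F summable_on (UNIV \<times> UNIV)"
    by (rule abs_summable_summable)
  then obtain S where S: "(F has_sum S) (UNIV \<times> UNIV)"
    by (auto simp: summable_on_def)
  have rows: "((\<lambda>j. F (i, j)) has_sum \<beta> i * (\<Sum>j. \<alpha> j * (q ^ i) ^ j)) UNIV" for i
  proof -
    have "((\<lambda>j. \<alpha> j * (q ^ i) ^ j) has_sum (\<Sum>j. \<alpha> j * (q ^ i) ^ j)) UNIV"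
      by (intro norm_summable_imp_has_sum summable_sums summable_norm_cancel[OF damped] damped \<alpha>)
    from has_sum_cmult_right[OF this, of "\<beta> i"] show ?thesis
      by (simp add: F_def power_mult mult_ac)
  qed
  have cols: "((\<lambda>i. F (i, j)) has_sum \<alpha> j * (\<Sum>i. \<beta> i * (q ^ j) ^ i)) UNIV" for j
  proof -
    have "((\<lambda>i. \<beta> i * (q ^ j) ^ i) has_sum (\<Sum>i. \<beta> i * (q ^ j) ^ i)) UNIV"
      by (intro norm_summable_imp_has_sum summable_sums summable_norm_cancel[OF damped] damped \<beta>)
    from has_sum_cmult_right[OF this, of "\<alpha> j"] show ?thesis
      by (simp add: F_def mult_ac flip: power_mult)
  qed
  show thesis
  proof (rule that[of S])
    show "(\<lambda>i. \<beta> i * (\<Sum>j. \<alpha> j * (q ^ i) ^ j)) sums S"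
      by (intro has_sum_imp_sums has_sum_SigmaD[OF S] rows)
    have "((\<lambda>(j, i). F (i, j)) has_sum S) (UNIV \<times> UNIV)"
      using S by (subst (asm) has_sum_swap)
    then show "(\<lambda>j. \<alpha> j * (\<Sum>i. \<beta> i * (q ^ j) ^ i)) sums S"
      by (rule has_sum_imp_sums[OF has_sum_SigmaD]) (simp add: cols)
    have bij: "bij_betw (\<lambda>(N, i). (i, N - i)) (Sigma UNIV (\<lambda>N. {..N})) (UNIV \<times> UNIV :: (nat \<times> nat) set)"
      by (rule bij_betwI[where g = "\<lambda>(i, j). (i + j, i)"]) auto
    have "((\<lambda>x. F (case x of (N, i) \<Rightarrow> (i, N - i))) has_sum S) (Sigma UNIV (\<lambda>N. {..N}))"
      by (rule has_sum_reindex_bij_betw[OF bij, THEN iffD2, OF S])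
    from has_sum_SigmaD[OF this, of "\<lambda>N. \<Sum>i\<le>N. F (i, N - i)"]
    have "((\<lambda>N. \<Sum>i\<le>N. F (i, N - i)) has_sum S) UNIV"
      by (simp add: has_sum_finite)
    then show "(\<lambda>N. \<Sum>i\<le>N. \<beta> i * \<alpha> (N - i) * q ^ (i * (N - i))) sums S"
      using has_sum_imp_sums by (simp add: F_def)
  qed
qed

lemma summable_norm_ramanujan:
  assumes "norm q < 1"
  shows "summable (\<lambda>n. norm (q ^ (n ^ 2) / qpoch q q n * x ^ n))"
proof -
  \<comment> \<open>The Gaussian factor $q^{n^2}$ is Euler's $q^{n(n-1)/2}$ times a bounded power.\<close>
  have "norm (q ^ ((n choose 2) + n)) \<le> 1" for n
    unfolding norm_power using assms by (intro power_le_one) auto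
  then have "summable (\<lambda>n. norm (euler_coeff q n * x ^ n * q ^ ((n choose 2) + n)))"
    by (intro summable_norm_mult_bounded summable_norm_euler assms)
  then show ?thesis
    by (simp add: euler_coeff_def square_eq_choose_two power_add mult_2 mult_ac)
qed

text \<open>
  Summing over $k$ first turns the inner series into Euler's expansion at $zq^m$; what is left is a
  single series over $m$.
\<close>

lemma ramanujan_transform:
  assumes q: "norm q < 1"
    and T: "(\<lambda>m. q ^ (m ^ 2) / qpoch q q m * (- b) ^ m * qpoch_inf (z * q ^ m) q) sums T"
  shows "(\<lambda>k. euler_coeff q k * (- z) ^ k * ramanujan_A q (b * q ^ k)) sums T"
proof -
  obtain S where
    S1: "(\<lambda>k. euler_coeff q k * (- z) ^ k
        * (\<Sum>m. q ^ (m ^ 2) / qpoch q q m * (- b) ^ m * (q ^ k) ^ m)) sums S" and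
    S2: "(\<lambda>m. q ^ (m ^ 2) / qpoch q q m * (- b) ^ m
        * (\<Sum>k. euler_coeff q k * (- z) ^ k * (q ^ m) ^ k)) sums S"
    by (rule gaussian_double_sums[OF summable_norm_euler[OF q, of "- z"]
          summable_norm_ramanujan[OF q, of "- b"] less_imp_le[OF q]]) (rule that)
  have scale: "c * (- x) ^ n * y ^ n = c * (- (x * y)) ^ n" for c x y :: complex and n
    by (simp only: mult.assoc mult_minus_left flip: power_mult_distrib)
  have "(\<Sum>m. q ^ (m ^ 2) / qpoch q q m * (- b) ^ m * (q ^ k) ^ m) = ramanujan_A q (b * q ^ k)" for k
    unfolding ramanujan_A_def scale ..
  moreover have "(\<Sum>k. euler_coeff q k * (- z) ^ k * (q ^ m) ^ k) = qpoch_inf (z * q ^ m) q" for m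
    unfolding scale by (rule sums_unique[OF euler_sums[OF q], symmetric])
  ultimately have "(\<lambda>k. euler_coeff q k * (- z) ^ k * ramanujan_A q (b * q ^ k)) sums S"
    and "(\<lambda>m. q ^ (m ^ 2) / qpoch q q m * (- b) ^ m * qpoch_inf (z * q ^ m) q) sums S"
    using S1 S2 by presburger+
  then show ?thesis
    using sums_unique2[OF T] by blast
qed

section \<open>Summations over shifted arguments\<close>

text \<open>
  The even and the odd part of a series are half the sum and half the difference of the series
  and its alternating version.
\<close>

lemma sums_parity_parts:
  fixes f :: "nat \<Rightarrow> complex"
  assumes "f sums a" and "(\<lambda>n. (- 1) ^ n * f n) sums b"
  shows "(\<lambda>n. f (2 * n)) sums ((a + b) / 2)" and "(\<lambda>n. f (2 * n + 1)) sums ((a - b) / 2)"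
proof -
  have "(\<lambda>n. (f n + (- 1) ^ n * f n) / 2) sums ((a + b) / 2)"
    by (intro sums_divide sums_add assms)
  then have "(\<lambda>n. (f (2 * n) + (- 1) ^ (2 * n) * f (2 * n)) / 2) sums ((a + b) / 2)"
    by (subst sums_mono_reindex[where g = "\<lambda>n. 2 * n"])
      (auto simp: strict_mono_def minus_one_power_iff elim!: oddE evenE)
  then show "(\<lambda>n. f (2 * n)) sums ((a + b) / 2)"
    by simp
  have "(\<lambda>n. (f n - (- 1) ^ n * f n) / 2) sums ((a - b) / 2)"
    by (intro sums_divide sums_diff assms)
  then have "(\<lambda>n. (f (2 * n + 1) - (- 1) ^ (2 * n + 1) * f (2 * n + 1)) / 2) sums ((a - b) / 2)"
    by (subst sums_mono_reindex[where g = "\<lambda>n. 2 * n + 1"])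
      (auto simp: strict_mono_def minus_one_power_iff elim!: oddE evenE)
  then show "(\<lambda>n. f (2 * n + 1)) sums ((a - b) / 2)"
    by simp
qed

text \<open>
  The first $n$ factors of $(-s^{-n};s)_\<infinity>$ are those of $(-s;s)_n$ in reversed order up to a
  power of $s$; the next one is $2$.
\<close>

lemma qpoch_inf_minus_inverse_power:
  assumes "norm s < 1" and "s \<noteq> 0"
  shows "qpoch_inf (- (1 / s ^ n)) s = 2 * qpoch (- s) s n * qpoch_inf (- s) s / s ^ (Suc n choose 2)"
proof -
  have fin: "qpoch (- (1 / s ^ n)) s n = qpoch (- s) s n / s ^ (Suc n choose 2)"
  proof (induction n)
    case (Suc n)
    have "qpoch (- (1 / s ^ Suc n)) s (Suc n)
        = (1 + 1 / s ^ Suc n) * qpoch (- (1 / s ^ n)) s n"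
      using assms(2) by (simp add: qpoch_Suc_left)
    also have "1 + 1 / s ^ Suc n = (1 - (- s) * s ^ n) / s ^ Suc n"
      using assms(2) by (simp add: field_simps)
    finally show ?case
      unfolding Suc.IH by (simp add: qpoch_Suc choose_two_Suc[of "Suc n"] power_add mult_ac)
  qed (simp add: numeral_2_eq_2)
  have "qpoch_inf (- (1 / s ^ n)) s = qpoch (- (1 / s ^ n)) s n * qpoch_inf (- 1) s"
    using qpoch_inf_split[OF assms(1), of "- (1 / s ^ n)" n] assms(2) by simp
  also have "qpoch_inf (- 1) s = 2 * qpoch_inf (- s) s"
    using qpoch_inf_split[OF assms(1), of "- 1" 1] by (simp add: qpoch_def)
  finally show ?thesis
    by (simp add: fin)
qed

lemma qpoch_inf_inverse_power:
  assumes "norm s < 1" and "s \<noteq> 0"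
  shows "qpoch_inf (1 / s ^ n) s = 0"
  using qpoch_inf_split[OF assms(1), of "1 / s ^ n" "Suc n"] assms(2) by (simp add: qpoch_Suc)

text \<open>
  At $z = s^{-n}$ the product $(z;s)_\<infinity>$ has a vanishing factor.  The alternating version of
  Euler's series therefore sums to $0$, and the even and the odd part both equal half of
  $(-s^{-n};s)_\<infinity>$.
\<close>

lemma euler_inverse_power_parts:
  fixes s :: complex and n :: nat
  assumes "norm s < 1" and "s \<noteq> 0"
  defines "c \<equiv> qpoch (- s) s n * qpoch_inf (- s) s / s ^ (Suc n choose 2)"
  shows "(\<lambda>m. euler_coeff s (2 * m) * (1 / s ^ n) ^ (2 * m)) sums c"
    and "(\<lambda>m. euler_coeff s (2 * m + 1) * (1 / s ^ n) ^ (2 * m + 1)) sums c"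
proof -
  have "qpoch_inf (- (1 / s ^ n)) s = 2 * c"
    using qpoch_inf_minus_inverse_power[OF assms(1,2), of n] by (simp add: c_def)
  then have 1: "(\<lambda>j. euler_coeff s j * (1 / s ^ n) ^ j) sums (2 * c)"
    using euler_sums[OF assms(1), of "- (1 / s ^ n)"] by simp
  have "(- 1) ^ j * (euler_coeff s j * (1 / s ^ n) ^ j) = euler_coeff s j * (- (1 / s ^ n)) ^ j" for j
    by (subst power_minus[of "1 / s ^ n"]) simp
  then have 2: "(\<lambda>j. (- 1) ^ j * (euler_coeff s j * (1 / s ^ n) ^ j)) sums 0"
    using euler_sums[OF assms(1), of "1 / s ^ n"] qpoch_inf_inverse_power[OF assms(1,2), of n]
    by (simp only:)
  show "(\<lambda>m. euler_coeff s (2 * m) * (1 / s ^ n) ^ (2 * m)) sums c"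
    and "(\<lambda>m. euler_coeff s (2 * m + 1) * (1 / s ^ n) ^ (2 * m + 1)) sums c"
    using sums_parity_parts[OF 1 2] by simp_all
qed

text \<open>
  After the transformation with $z = -q$ the factors $(q;q)_m (-q;q)_m$ combine to $(q^2;q^2)_m$, and the
  remaining series is Euler's expansion in base $q^2$.
\<close>

lemma series_at_even_shifts:
  fixes q a :: complex
  assumes q0: "q \<noteq> 0" and q: "norm q < 1"
  shows "(\<lambda>k. q ^ ((k + 1) choose 2) * ramanujan_A q (a * q powi (int k - 2 * int n)) / qpoch q q k)
        sums (qpoch_inf (- q) q * qpoch_inf (a * q powi (1 - 2 * int n)) (q ^ 2))"
proof -
  define b where "b = a / q ^ (2 * n)"
  have arg: "a * q powi (int k - 2 * int n) = b * q ^ k" for k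
    using q0 by (simp add: b_def power_int_diff power_int_mult power_mult)
  have bq: "a * q powi (1 - 2 * int n) = b * q"
    using q0 by (simp add: b_def power_int_diff power_int_mult power_mult)
  have q2: "norm (q ^ 2) < 1"
    using q by (simp add: norm_power power_less_one_iff)
  have term_eq: "qpoch_inf (- q) q * (euler_coeff (q ^ 2) m * (- (b * q)) ^ m)
      = q ^ (m ^ 2) / qpoch q q m * (- b) ^ m * qpoch_inf (- q * q ^ m) q" for m
  proof -
    have "qpoch (q ^ 2) (q ^ 2) m = qpoch q q m * qpoch (- q) q m"
      by (simp add: qpoch_minus)
    moreover have "qpoch (q ^ 2) (q ^ 2) m \<noteq> 0"
      by (rule qpoch_self_nonzero[OF q2])
    moreover have "(q ^ 2) ^ (m choose 2) * (- (b * q)) ^ m = q ^ (m ^ 2) * (- b) ^ m"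
      using power_mult_distrib[of "- b" q m]
      by (simp add: square_eq_choose_two power_add power_mult)
    ultimately show ?thesis
      using qpoch_inf_split[OF q, of "- q" m] by (simp add: euler_coeff_def)
  qed
  have "(\<lambda>m. q ^ (m ^ 2) / qpoch q q m * (- b) ^ m * qpoch_inf (- q * q ^ m) q)
      sums (qpoch_inf (- q) q * qpoch_inf (b * q) (q ^ 2))"
    using sums_mult[OF euler_sums[OF q2, of "b * q"], of "qpoch_inf (- q) q"]
    by (simp only: term_eq)
  from ramanujan_transform[OF q this] show ?thesis
    unfolding arg bq by (simp add: euler_coeff_def choose_two_Suc power_add mult_ac)
qed

text \<open>
  The value common to both series below: the infinite products cancel by Euler's identity and
  only $(-s;s)_n = (s^2;s^2)_n / (s;s)_n$ survives.
\<close>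

lemma qpoch_inf_odd_mult_parity_part:
  assumes s: "norm s < 1"
  shows "qpoch_inf s (s ^ 2) * (qpoch (- s) s n * qpoch_inf (- s) s / s ^ (Suc n choose 2))
    = qpoch (s ^ 2) (s ^ 2) n / (s ^ (Suc n choose 2) * qpoch s s n)"
proof -
  have "qpoch_inf s (s ^ 2) * (qpoch (- s) s n * qpoch_inf (- s) s / s ^ (Suc n choose 2))
      = (qpoch_inf s (s ^ 2) * qpoch_inf (- s) s) * qpoch (- s) s n / s ^ (Suc n choose 2)"
    by simp
  also have "\<dots> = qpoch (- s) s n / s ^ (Suc n choose 2)"
    unfolding qpoch_inf_odd_mult_minus[OF s] by simp
  finally show ?thesis
    using qpoch_self_nonzero[OF s, of n] by (simp flip: qpoch_minus)
qed

text \<open>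
  Now $z = s^3$.  The denominators $(s^2;s^2)_m$ and $(s;s^2)_{m+1}$ interlace to $(s;s)_{2m+1}$, so that the
  transformed series is a multiple of the odd part of Euler's series in base $s$ at $s^{-n}$.
\<close>

lemma series_at_odd_powers_above:
  fixes s :: complex
  assumes s0: "s \<noteq> 0" and s: "norm s < 1"
  defines "q \<equiv> s ^ 2"
  shows "(\<lambda>k. q ^ (k choose 2) * (- (s ^ 3)) ^ k
            * ramanujan_A q (- (s powi (2 * int k - 2 * int n + 1))) / qpoch q q k)
        sums (qpoch q q n / (s ^ (n * (n - 1) div 2) * qpoch s s n))"
proof -
  have q: "norm q < 1"
    using s by (simp add: q_def norm_power power_less_one_iff)
  define x where "x = 1 / s ^ n"
  have x0: "x \<noteq> 0"
    using s0 by (simp add: x_def)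
  have arg: "s powi (2 * int k - 2 * int n + 1) = s * x ^ 2 * q ^ k" for k
    using s0 by (simp add: x_def q_def power_int_diff power_int_add power_int_mult power_one_over
        field_simps flip: power_mult)
  have term_eq: "qpoch_inf s q / x * (euler_coeff s (2 * m + 1) * x ^ (2 * m + 1))
      = q ^ (m ^ 2) / qpoch q q m * (- (- (s * x ^ 2))) ^ m * qpoch_inf (s ^ 3 * q ^ m) q" for m
  proof -
    have "qpoch s s (2 * m + 1) = qpoch q q m * qpoch s q (Suc m)"
      by (simp add: qpoch_Suc qpoch_bisect q_def power_mult flip: power2_eq_square)
    moreover have "qpoch s s (2 * m + 1) \<noteq> 0"
      by (rule qpoch_self_nonzero[OF s])
    moreover have "qpoch_inf s q = qpoch s q (Suc m) * qpoch_inf (s ^ 3 * q ^ m) q"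
      using qpoch_inf_split[OF q, of s "Suc m"]
      by (simp add: q_def power2_eq_square power3_eq_cube mult_ac)
    moreover have "s ^ ((2 * m + 1) choose 2) * x ^ (2 * m + 1) = q ^ (m ^ 2) * (s * x ^ 2) ^ m * x"
    proof -
      have "(2 * m + 1) choose 2 = 2 * m ^ 2 + m"
        using choose_two_add[of m m] by (simp add: choose_two_Suc square_eq_choose_two mult_2
            flip: power2_eq_square)
      then show ?thesis
        by (simp add: q_def power_add power_mult power_mult_distrib)
    qed
    ultimately show ?thesis
      using x0 by (simp add: euler_coeff_def field_simps)
  qed
  have "(\<lambda>m. q ^ (m ^ 2) / qpoch q q m * (- (- (s * x ^ 2))) ^ m * qpoch_inf (s ^ 3 * q ^ m) q)
      sums (qpoch_inf s q / x * (qpoch (- s) s n * qpoch_inf (- s) s / s ^ (Suc n choose 2)))"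
    using sums_mult[OF euler_inverse_power_parts(2)[OF s s0, of n], of "qpoch_inf s q / x"]
    unfolding x_def[symmetric] by (simp only: term_eq)
  also have "qpoch_inf s q / x * (qpoch (- s) s n * qpoch_inf (- s) s / s ^ (Suc n choose 2))
      = qpoch q q n / (s ^ (n * (n - 1) div 2) * qpoch s s n)"
    using qpoch_inf_odd_mult_parity_part[OF s, of n] s0 unfolding choose_two[of n, symmetric]
    by (simp add: q_def x_def choose_two_Suc power_add field_simps)
  finally show ?thesis
    unfolding arg using ramanujan_transform[OF q, of "- (s * x ^ 2)" "s ^ 3"]
    by (simp add: euler_coeff_def)
qed

text \<open>
  With $z = s$ the denominators interlace to $(s;s)_{2m}$, and the even part of the same
  series appears, again up to a constant factor.
\<close>

lemma series_at_odd_powers_below: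
  fixes s :: complex
  assumes s0: "s \<noteq> 0" and s: "norm s < 1"
  defines "q \<equiv> s ^ 2"
  shows "(\<lambda>k. s ^ (k ^ 2) * (- 1) ^ k
            * ramanujan_A q (- (s powi (2 * int k - 2 * int n - 1))) / qpoch q q k)
        sums (qpoch q q n / (s ^ (n * (n + 1) div 2) * qpoch s s n))"
proof -
  have q: "norm q < 1"
    using s by (simp add: q_def norm_power power_less_one_iff)
  define x where "x = 1 / s ^ n"
  have arg: "s powi (2 * int k - 2 * int n - 1) = x ^ 2 / s * q ^ k" for k
    using s0 by (simp add: x_def q_def power_int_diff power_int_add power_int_mult power_one_over
        field_simps flip: power_mult)
  have term_eq: "qpoch_inf s q * (euler_coeff s (2 * m) * x ^ (2 * m))
      = q ^ (m ^ 2) / qpoch q q m * (- (- (x ^ 2 / s))) ^ m * qpoch_inf (s * q ^ m) q" for m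
  proof -
    have "qpoch s s (2 * m) = qpoch q q m * qpoch s q m"
      by (simp add: qpoch_bisect q_def flip: power2_eq_square)
    moreover have "qpoch s s (2 * m) \<noteq> 0"
      by (rule qpoch_self_nonzero[OF s])
    moreover have "qpoch_inf s q = qpoch s q m * qpoch_inf (s * q ^ m) q"
      by (rule qpoch_inf_split[OF q])
    moreover have "s ^ ((2 * m) choose 2) * x ^ (2 * m) = q ^ (m ^ 2) * (x ^ 2 / s) ^ m"
    proof -
      have "2 * m ^ 2 = ((2 * m) choose 2) + m"
        using choose_two_add[of m m] by (simp add: square_eq_choose_two mult_2
            flip: power2_eq_square)
      then have "q ^ (m ^ 2) = s ^ ((2 * m) choose 2) * s ^ m"
        by (simp add: q_def flip: power_mult power_add)
      then show ?thesis
        using s0 by (simp add: power_mult power_divide)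
    qed
    ultimately show ?thesis
      by (simp add: euler_coeff_def field_simps)
  qed
  have "(\<lambda>m. q ^ (m ^ 2) / qpoch q q m * (- (- (x ^ 2 / s))) ^ m * qpoch_inf (s * q ^ m) q)
      sums (qpoch_inf s q * (qpoch (- s) s n * qpoch_inf (- s) s / s ^ (Suc n choose 2)))"
    using sums_mult[OF euler_inverse_power_parts(1)[OF s s0, of n], of "qpoch_inf s q"]
    unfolding x_def[symmetric] by (simp only: term_eq)
  also have "qpoch_inf s q * (qpoch (- s) s n * qpoch_inf (- s) s / s ^ (Suc n choose 2))
      = qpoch q q n / (s ^ (n * (n + 1) div 2) * qpoch s s n)"
    using qpoch_inf_odd_mult_parity_part[OF s, of n] choose_two[of "Suc n"]
    by (simp add: q_def mult.commute)
  finally have T: "(\<lambda>m. q ^ (m ^ 2) / qpoch q q m * (- (- (x ^ 2 / s))) ^ m * qpoch_inf (s * q ^ m) q)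
      sums (qpoch q q n / (s ^ (n * (n + 1) div 2) * qpoch s s n))" .
  have "q ^ (k choose 2) * (- s) ^ k = s ^ (k ^ 2) * (- 1) ^ k" for k
    using power_mult_distrib[of "- 1" s k]
    by (simp add: q_def square_eq_choose_two power_add power_mult)
  then show ?thesis
    using ramanujan_transform[OF q T] by (simp add: arg euler_coeff_def)
qed

section \<open>Product identities for formal power series\<close>

unbundle fps_syntax
no_notation vec_nth (infixl "$" 90)

text \<open>
  The substitution $X \<mapsto> pX$, under which Euler's series satisfies a first-order functional equation.
\<close>

definition dilate :: "complex \<Rightarrow> complex fps \<Rightarrow> complex fps" where
  "dilate p F = F oo (fps_const p * fps_X)"

lemma dilate_nth [simp]: "dilate p F $ n = p ^ n * F $ n"
  by (simp add: dilate_def)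

lemma dilate_mult: "dilate p (F * G) = dilate p F * dilate p G"
  by (simp add: dilate_def fps_compose_mult_distrib)

text \<open>
  Euler's series for $(cX;p)_\<infinity>$.
\<close>

definition euler_fps :: "complex \<Rightarrow> complex \<Rightarrow> complex fps" where
  "euler_fps p c = Abs_fps (\<lambda>n. euler_coeff p n * (- c) ^ n)"

text \<open>
  The expansion of $1/(cX;p)_\<infinity>$, Euler's other identity.
\<close>

definition euler_inverse_fps :: "complex \<Rightarrow> complex \<Rightarrow> complex fps" where
  "euler_inverse_fps p c = Abs_fps (\<lambda>n. c ^ n / qpoch p p n)"

lemma fps_linear_mult_nth_Suc:
  "((1 - fps_const c * fps_X) * F) $ Suc n = F $ Suc n - c * F $ n" for c :: complex
  by (simp add: left_diff_distrib mult.assoc)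

lemma euler_fps_functional_equation:
  assumes "norm p < 1"
  shows "euler_fps p c = (1 - fps_const c * fps_X) * euler_fps p (c * p)"
proof (rule fps_ext)
  fix n
  show "euler_fps p c $ n = ((1 - fps_const c * fps_X) * euler_fps p (c * p)) $ n"
  proof (cases n)
    case (Suc m)
    have "(euler_coeff p (Suc m) * (1 - p ^ Suc m)) * (- c) ^ Suc m
        = (euler_coeff p m * p ^ m) * (- c) ^ Suc m"
      by (simp only: euler_coeff_rec[OF assms])
    moreover have "(- (c * p)) ^ k = (- c) ^ k * p ^ k" for k
      by (simp flip: power_mult_distrib)
    ultimately show ?thesis
      unfolding Suc fps_linear_mult_nth_Suc by (simp add: euler_fps_def algebra_simps)
  qed (simp add: euler_fps_def)
qed

lemma dilate_euler_fps: "dilate p (euler_fps r c) = euler_fps r (c * p)"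
proof (rule fps_ext)
  have "(- (c * p)) ^ n = (- c) ^ n * p ^ n" for n
    by (simp flip: power_mult_distrib)
  then show "dilate p (euler_fps r c) $ n = euler_fps r (c * p) $ n" for n
    by (simp add: euler_fps_def)
qed

lemma dilate_euler_inverse_fps:
  assumes "norm p < 1"
  shows "dilate p (euler_inverse_fps p c) = (1 - fps_const c * fps_X) * euler_inverse_fps p c"
proof (rule fps_ext)
  fix n
  show "dilate p (euler_inverse_fps p c) $ n
      = ((1 - fps_const c * fps_X) * euler_inverse_fps p c) $ n"
  proof (cases n)
    case (Suc m)
    then show ?thesis
      unfolding Suc fps_linear_mult_nth_Suc
      using qpoch_self_nonzero[OF assms, of "Suc m"]
      by (simp add: euler_inverse_fps_def qpoch_Suc field_simps)
  qed (simp add: euler_inverse_fps_def)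
qed

text \<open>
  Comparing coefficients in $F(X) = (1 - cX) F(pX)$ gives
  $(1 - p^{n+1}) F_{n+1} = -c p^n F_n$, which determines $F$ from its constant term.
\<close>

lemma euler_fps_unique:
  assumes p: "norm p < 1" and F0: "F $ 0 = 1"
    and F: "F = (1 - fps_const c * fps_X) * dilate p F"
  shows "F = euler_fps p c"
proof (rule fps_ext)
  fix n
  show "F $ n = euler_fps p c $ n"
  proof (induction n)
    case (Suc n)
    have "G $ Suc n * (1 - p ^ Suc n) = - c * p ^ n * G $ n"
      if "G = (1 - fps_const c * fps_X) * dilate p G" for G
      using arg_cong[OF that, of "\<lambda>H. H $ Suc n"] unfolding fps_linear_mult_nth_Suc
      by (simp add: algebra_simps)
    note rec = this
    have "euler_fps p c = (1 - fps_const c * fps_X) * dilate p (euler_fps p c)"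
      unfolding dilate_euler_fps by (rule euler_fps_functional_equation[OF p])
    from rec[OF F] rec[OF this] have
      "F $ Suc n * (1 - p ^ Suc n) = euler_fps p c $ Suc n * (1 - p ^ Suc n)"
      by (simp only: Suc.IH)
    then show ?case
      using power_neq_1[OF p, of "Suc n"] by simp
  qed (simp add: F0 euler_fps_def)
qed

text \<open>
  In product notation
  $(-X;s)_\<infinity> = (-X;s^2)_\<infinity> (-sX;s^2)_\<infinity>$; dividing by either factor leaves the other.
  Formally, both sides satisfy the same functional equation under $X \<mapsto> s^2 X$.
\<close>

lemma euler_fps_base_change:
  assumes s: "norm s < 1"
  shows "euler_fps s (- 1) * euler_inverse_fps (s ^ 2) (- 1) = euler_fps (s ^ 2) (- s)"
    and "euler_fps s (- 1) * euler_inverse_fps (s ^ 2) (- s) = euler_fps (s ^ 2) (- 1)"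
proof -
  have q: "norm (s ^ 2) < 1"
    using s by (simp add: norm_power power_less_one_iff)
  have two_steps: "euler_fps s (- 1)
      = (1 - fps_const (- 1) * fps_X) * ((1 - fps_const (- s) * fps_X) * dilate (s ^ 2) (euler_fps s (- 1)))"
    unfolding dilate_euler_fps
    by (subst euler_fps_functional_equation[OF s], subst euler_fps_functional_equation[OF s])
      (simp add: power2_eq_square)
  show "euler_fps s (- 1) * euler_inverse_fps (s ^ 2) (- 1) = euler_fps (s ^ 2) (- s)"
  proof (rule euler_fps_unique[OF q])
    show "euler_fps s (- 1) * euler_inverse_fps (s ^ 2) (- 1) = (1 - fps_const (- s) * fps_X)
        * dilate (s ^ 2) (euler_fps s (- 1) * euler_inverse_fps (s ^ 2) (- 1))"
      unfolding dilate_mult dilate_euler_inverse_fps[OF q] by (subst two_steps) (simp only: mult_ac)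
  qed (simp add: euler_fps_def euler_inverse_fps_def)
  show "euler_fps s (- 1) * euler_inverse_fps (s ^ 2) (- s) = euler_fps (s ^ 2) (- 1)"
  proof (rule euler_fps_unique[OF q])
    show "euler_fps s (- 1) * euler_inverse_fps (s ^ 2) (- s) = (1 - fps_const (- 1) * fps_X)
        * dilate (s ^ 2) (euler_fps s (- 1) * euler_inverse_fps (s ^ 2) (- s))"
      unfolding dilate_mult dilate_euler_inverse_fps[OF q] by (subst two_steps) (simp only: mult_ac)
  qed (simp add: euler_fps_def euler_inverse_fps_def)
qed

text \<open>
  Euler's series for $(X^2;q^2)_\<infinity>$, as a series in $X$.
\<close>

definition euler_square_fps :: "complex \<Rightarrow> complex fps" where
  "euler_square_fps q = Abs_fps (\<lambda>i. if even i then euler_coeff (q ^ 2) (i div 2) * (- 1) ^ (i div 2) else 0)"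

text \<open>
  This is $(X^2;q^2)_\<infinity> = (1 - X^2) (q^2X^2;q^2)_\<infinity>$.  The factor $1 - X^2$ is kept split
  because $1 - X$ is what $1/(X;q)_\<infinity>$ picks up under $X \<mapsto> qX$.
\<close>

lemma euler_square_fps_functional_equation:
  assumes q: "norm q < 1"
  shows "euler_square_fps q
    = (1 - fps_const 1 * fps_X) * ((1 - fps_const (- 1) * fps_X) * dilate q (euler_square_fps q))"
    (is "?E = _")
proof (rule fps_ext)
  fix n
  have q2: "norm (q ^ 2) < 1"
    using q by (simp add: norm_power power_less_one_iff)
  have rec: "?E $ Suc (Suc k) = q ^ Suc (Suc k) * ?E $ Suc (Suc k) - q ^ k * ?E $ k" for k
  proof (cases "even k")
    case True
    then obtain m where k: "k = 2 * m"
      by (elim evenE)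
    define u where "u = (- 1 :: complex) ^ m"
    have "?E $ Suc (Suc k) = - (euler_coeff (q ^ 2) (Suc m) * u)"
      by (simp add: euler_square_fps_def k u_def)
    also have "\<dots> = - (euler_coeff (q ^ 2) (Suc m) * (q ^ 2) ^ Suc m * u)
        - euler_coeff (q ^ 2) (Suc m) * (1 - (q ^ 2) ^ Suc m) * u"
      by (simp add: algebra_simps)
    also have "\<dots> = q ^ Suc (Suc k) * ?E $ Suc (Suc k) - q ^ k * ?E $ k"
      unfolding euler_coeff_rec[OF q2, of m]
      by (simp add: euler_square_fps_def k u_def power_mult power_mult_distrib power2_eq_square mult_ac)
    finally show ?thesis .
  qed (simp add: euler_square_fps_def)
  show "?E $ n = ((1 - fps_const 1 * fps_X) * ((1 - fps_const (- 1) * fps_X) * dilate q ?E)) $ n"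
  proof -
    consider "n = 0" | "n = 1" | k where "n = Suc (Suc k)"
      by (metis One_nat_def not0_implies_Suc)
    then show ?thesis
    proof cases
      case 3
      then show ?thesis
        unfolding 3 fps_linear_mult_nth_Suc using rec[of k] by simp
    next
      case 2
      then show ?thesis
        unfolding 2 One_nat_def fps_linear_mult_nth_Suc by (simp add: euler_square_fps_def)
    qed (simp add: euler_square_fps_def)
  qed
qed

text \<open>
  This is $(X^2;q^2)_\<infinity> / (X;q)_\<infinity> = (-X;q)_\<infinity>$.
\<close>

lemma euler_square_fps_divide:
  assumes q: "norm q < 1"
  shows "euler_square_fps q * euler_inverse_fps q 1 = euler_fps q (- 1)"
proof (rule euler_fps_unique[OF q])
  show "euler_square_fps q * euler_inverse_fps q 1
      = (1 - fps_const (- 1) * fps_X) * dilate q (euler_square_fps q * euler_inverse_fps q 1)"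
    unfolding dilate_mult dilate_euler_inverse_fps[OF q]
    by (subst euler_square_fps_functional_equation[OF q]) (simp only: mult_ac)
qed (simp add: euler_square_fps_def euler_inverse_fps_def)

section \<open>Expansions of the Ramanujan function\<close>

text \<open>
  Since $(z;q)_\<infinity> / (z;q)_i = (zq^i;q)_\<infinity>$, expanding each of these products by Euler's
  series gives a double series with kernel $q^{ij}$.  Summed along antidiagonals it is a power
  series, and the convolution hypothesis says that its coefficients are those of $A_q(w)$.
\<close>

lemma ramanujan_expansion:
  assumes q: "norm q < 1" and \<beta>: "summable (\<lambda>i. norm (\<beta> i))" and nz: "\<And>i. qpoch z q i \<noteq> 0"
    and conv: "\<And>N. (\<Sum>i\<le>N. \<beta> i * (euler_coeff q (N - i) * (- z) ^ (N - i)) * q ^ (i * (N - i)))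
      = q ^ (N ^ 2) / qpoch q q N * (- w) ^ N"
  shows "(\<lambda>i. \<beta> i / qpoch z q i) sums (ramanujan_A q w / qpoch_inf z q)"
proof -
  have z: "qpoch_inf z q \<noteq> 0"
    by (rule qpoch_inf_nonzero[OF q nz])
  obtain S where
    S1: "(\<lambda>i. \<beta> i * (\<Sum>j. euler_coeff q j * (- z) ^ j * (q ^ i) ^ j)) sums S" and
    S2: "(\<lambda>N. \<Sum>i\<le>N. \<beta> i * (euler_coeff q (N - i) * (- z) ^ (N - i)) * q ^ (i * (N - i))) sums S"
    by (rule gaussian_double_sums[OF summable_norm_euler[OF q, of "- z"] \<beta> less_imp_le[OF q]])
      (rule that)
  have "\<beta> i * (\<Sum>j. euler_coeff q j * (- z) ^ j * (q ^ i) ^ j) = \<beta> i / qpoch z q i * qpoch_inf z q" for i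
  proof -
    have "euler_coeff q j * (- z) ^ j * (q ^ i) ^ j = euler_coeff q j * (- (z * q ^ i)) ^ j" for j
      by (simp only: mult.assoc mult_minus_left flip: power_mult_distrib)
    note shift = this
    show ?thesis
      unfolding shift
      using sums_unique[OF euler_sums[OF q, of "z * q ^ i"]] qpoch_inf_split[OF q, of z i] nz[of i]
      by simp
  qed
  then have "(\<lambda>i. \<beta> i / qpoch z q i * qpoch_inf z q) sums S"
    using S1 by (simp only:)
  then have "(\<lambda>i. \<beta> i / qpoch z q i) sums (S / qpoch_inf z q)"
    using sums_divide[of "\<lambda>i. \<beta> i / qpoch z q i * qpoch_inf z q" S "qpoch_inf z q"] z by simp
  moreover have "S = ramanujan_A q w"
    using S2 unfolding conv ramanujan_A_def by (rule sums_unique)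
  ultimately show ?thesis
    by simp
qed

text \<open>
  Since $2ij = (i + j)^2 - i^2 - j^2$, the kernel $q^{ij}$ can be traded for a factor depending only on
  $i + j$ and factors depending on $i$ or on $j$ alone.  After that the convolution is a
  coefficient of a product of two formal power series.
\<close>

lemma convolution_eq_fps_mult_nth:
  assumes "\<And>i j. \<beta> i * (euler_coeff q j * (- z) ^ j) * q ^ (i * j) = C (i + j) * (F $ i * G $ j)"
  shows "(\<Sum>i\<le>N. \<beta> i * (euler_coeff q (N - i) * (- z) ^ (N - i)) * q ^ (i * (N - i)))
    = C N * (F * G) $ N"
  unfolding fps_mult_nth sum_distrib_left atLeast0AtMost
  by (intro sum.cong refl, subst assms) simp

lemma neg_power_split: "w ^ j = (- w) ^ j * (- 1) ^ j" for w :: complex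
  by (simp flip: power_mult_distrib)

text \<open>
  The convolution reduces to $(-X;s)_\<infinity> / (-X;s^2)_\<infinity> = (-sX;s^2)_\<infinity>$.
\<close>

lemma expansion_minus_half:
  fixes s w :: complex
  assumes s: "norm s < 1"
  defines "q \<equiv> s ^ 2"
  assumes nz: "\<And>i. qpoch (- (w * s)) q i \<noteq> 0"
  shows "(\<lambda>m. s ^ (m * (3 * m - 1) div 2) * (- w) ^ m / (qpoch s s m * qpoch (- (w * s)) q m))
    sums (ramanujan_A q w / qpoch_inf (- (w * s)) q)"
proof -
  have q: "norm q < 1"
    using s by (simp add: q_def norm_power power_less_one_iff)
  \<comment> \<open>The numerator of the series, with the coefficient of Euler's series in base \<open>s\<close> split off.\<close>
  define \<beta> where "\<beta> i = euler_coeff s i * (- w) ^ i * s ^ (2 * (i choose 2) + i)" for i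
  have "norm (s ^ k) \<le> 1" for k
    unfolding norm_power using s by (intro power_le_one) auto
  then have \<beta>: "summable (\<lambda>i. norm (\<beta> i))"
    unfolding \<beta>_def by (intro summable_norm_mult_bounded summable_norm_euler s)
  have coeff: "\<beta> i * (euler_coeff q j * (- (- (w * s))) ^ j) * q ^ (i * j)
      = (s ^ ((i + j) ^ 2) * (- w) ^ (i + j))
        * (euler_fps s (- 1) $ i * euler_inverse_fps q (- 1) $ j)" for i j
  proof -
    have "q ^ (j choose 2) * q ^ (i * j) * s ^ j * s ^ (2 * (i choose 2) + i) = s ^ ((i + j) ^ 2)"
      by (simp add: q_def square_eq_choose_two choose_two_add algebra_simps
          flip: power_mult power_add)
    then show ?thesis
      by (simp add: \<beta>_def euler_fps_def euler_inverse_fps_def euler_coeff_def power_mult_distrib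
          power_add neg_power_split[of w j] field_simps)
  qed
  have "(\<Sum>i\<le>N. \<beta> i * (euler_coeff q (N - i) * (- (- (w * s))) ^ (N - i)) * q ^ (i * (N - i)))
      = q ^ (N ^ 2) / qpoch q q N * (- w) ^ N" for N
  proof -
    have "(euler_fps s (- 1) * euler_inverse_fps q (- 1)) $ N = s ^ (N ^ 2) / qpoch q q N"
      using euler_fps_base_change(1)[OF s]
      by (simp add: q_def euler_fps_def euler_coeff_def square_eq_choose_two power_add power_mult)
    then show ?thesis
      unfolding convolution_eq_fps_mult_nth[where C = "\<lambda>N. s ^ (N ^ 2) * (- w) ^ N", OF coeff]
      by (simp add: q_def mult_2 power_add flip: power_mult)
  qed
  from ramanujan_expansion[OF q \<beta> nz this]
  have "(\<lambda>i. \<beta> i / qpoch (- (w * s)) q i) sums (ramanujan_A q w / qpoch_inf (- (w * s)) q)" .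
  moreover have "s ^ (i * (3 * i - 1) div 2) = s ^ (i choose 2) * s ^ (2 * (i choose 2) + i)" for i
  proof -
    have "i * (3 * i - 1) = 2 * (3 * (i choose 2) + i)"
      using square_eq_choose_two[of i] by (cases i) (auto simp: power2_eq_square algebra_simps)
    then show ?thesis
      by (simp flip: power_add)
  qed
  ultimately show ?thesis
    by (simp add: \<beta>_def euler_coeff_def mult_ac)
qed

text \<open>
  The convolution reduces to $(-X;s)_\<infinity> / (-sX;s^2)_\<infinity> = (-X;s^2)_\<infinity>$.
\<close>

lemma expansion_minus_three_halves:
  fixes s w :: complex
  assumes s: "norm s < 1"
  defines "q \<equiv> s ^ 2"
  assumes nz: "\<And>i. qpoch (- (w * s ^ 3)) q i \<noteq> 0"
  shows "(\<lambda>m. s ^ (m * (3 * m + 1) div 2) * (- w) ^ m / (qpoch s s m * qpoch (- (w * s ^ 3)) q m))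
    sums (ramanujan_A q w / qpoch_inf (- (w * s ^ 3)) q)"
proof -
  have q: "norm q < 1"
    using s by (simp add: q_def norm_power power_less_one_iff)
  \<comment> \<open>The numerator of the series, with the coefficient of Euler's series in base \<open>s\<close> split off.\<close>
  define \<beta> where "\<beta> i = euler_coeff s i * (- w) ^ i * s ^ (2 * (i choose 2) + 2 * i)" for i
  have "norm (s ^ k) \<le> 1" for k
    unfolding norm_power using s by (intro power_le_one) auto
  then have \<beta>: "summable (\<lambda>i. norm (\<beta> i))"
    unfolding \<beta>_def by (intro summable_norm_mult_bounded summable_norm_euler s)
  have coeff: "\<beta> i * (euler_coeff q j * (- (- (w * s ^ 3))) ^ j) * q ^ (i * j)
      = (s ^ ((i + j) ^ 2 + (i + j)) * (- w) ^ (i + j))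
        * (euler_fps s (- 1) $ i * euler_inverse_fps q (- s) $ j)" for i j
  proof -
    have "q ^ (j choose 2) * q ^ (i * j) * (s ^ 3) ^ j * s ^ (2 * (i choose 2) + 2 * i)
        = s ^ ((i + j) ^ 2 + (i + j)) * s ^ j"
      by (simp add: q_def square_eq_choose_two choose_two_add algebra_simps
          flip: power_mult power_add)
    moreover have "(- s) ^ j = s ^ j * (- 1) ^ j"
      by (simp flip: power_mult_distrib)
    ultimately show ?thesis
      by (simp add: \<beta>_def euler_fps_def euler_inverse_fps_def euler_coeff_def power_mult_distrib
          power_add neg_power_split[of w j] field_simps)
  qed
  have "(\<Sum>i\<le>N. \<beta> i * (euler_coeff q (N - i) * (- (- (w * s ^ 3))) ^ (N - i)) * q ^ (i * (N - i)))
      = q ^ (N ^ 2) / qpoch q q N * (- w) ^ N" for N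
  proof -
    have "(euler_fps s (- 1) * euler_inverse_fps q (- s)) $ N = q ^ (N choose 2) / qpoch q q N"
      using euler_fps_base_change(2)[OF s]
      by (simp add: q_def euler_fps_def euler_coeff_def)
    moreover have "s ^ (N ^ 2 + N) * q ^ (N choose 2) = q ^ (N ^ 2)"
      by (simp add: q_def square_eq_choose_two flip: power_mult power_add)
    ultimately show ?thesis
      unfolding convolution_eq_fps_mult_nth[where C = "\<lambda>N. s ^ (N ^ 2 + N) * (- w) ^ N", OF coeff]
      by (simp add: mult_ac)
  qed
  from ramanujan_expansion[OF q \<beta> nz this]
  have "(\<lambda>i. \<beta> i / qpoch (- (w * s ^ 3)) q i) sums (ramanujan_A q w / qpoch_inf (- (w * s ^ 3)) q)" .
  moreover have "s ^ (i * (3 * i + 1) div 2) = s ^ (i choose 2) * s ^ (2 * (i choose 2) + 2 * i)" for i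
  proof -
    have "i * (3 * i + 1) = 2 * (3 * (i choose 2) + 2 * i)"
      using square_eq_choose_two[of i] by (auto simp: power2_eq_square algebra_simps)
    then show ?thesis
      by (simp add: add.commute flip: power_add)
  qed
  ultimately show ?thesis
    by (simp add: \<beta>_def euler_coeff_def mult_ac)
qed

text \<open>
  The denominators interlace to $(wq;q)_{2m}$, so the series is the part with even $i$ of a
  series over all $i$ with vanishing odd terms.  The convolution then reduces to
  $(X^2;q^2)_\<infinity> / (X;q)_\<infinity> = (-X;q)_\<infinity>$.
\<close>

lemma expansion_base_square:
  fixes q w :: complex
  assumes q: "norm q < 1" and nz: "\<And>i. qpoch (w * q) q i \<noteq> 0"
  shows "(\<lambda>m. q ^ (3 * m ^ 2) * (- (w ^ 2)) ^ m /
      (qpoch (q ^ 2) (q ^ 2) m * qpoch (w * q) (q ^ 2) m * qpoch (w * q ^ 2) (q ^ 2) m))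
    sums (ramanujan_A q w / qpoch_inf (w * q) q)"
proof -
  have q2: "norm (q ^ 2) < 1"
    using q by (simp add: norm_power power_less_one_iff)
  \<comment> \<open>The numerator of the series, with the coefficient of Euler's series in base \<open>q ^ 2\<close> split off.\<close>
  define b where "b m = euler_coeff (q ^ 2) m * (- (w ^ 2)) ^ m * q ^ (4 * (m choose 2) + 3 * m)" for m
  define \<beta> where "\<beta> i = (if even i then b (i div 2) else 0)" for i
  have reindex: "strict_mono (\<lambda>m. 2 * m :: nat)"
    by (simp add: strict_mono_def)
  have "norm (q ^ k) \<le> 1" for k
    unfolding norm_power using q by (intro power_le_one) auto
  then have "summable (\<lambda>m. norm (b m))"
    unfolding b_def by (intro summable_norm_mult_bounded summable_norm_euler q2)
  then have "summable (\<lambda>m. norm (\<beta> (2 * m)))"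
    by (simp add: \<beta>_def)
  then have \<beta>: "summable (\<lambda>i. norm (\<beta> i))"
    by (subst (asm) summable_mono_reindex[OF reindex]) (auto simp: \<beta>_def elim!: evenE)
  have coeff: "\<beta> i * (euler_coeff q j * (- (w * q)) ^ j) * q ^ (i * j)
      = (q ^ (((i + j) choose 2) + (i + j)) * (- w) ^ (i + j))
        * (euler_square_fps q $ i * euler_inverse_fps q 1 $ j)" for i j
  proof (cases "even i")
    case True
    then obtain m where i: "i = 2 * m"
      by (elim evenE)
    define E where "E = ((i + j) choose 2) + (i + j)"
    have "(2 * m) choose 2 = 4 * (m choose 2) + m"
      using choose_two_add[of m m] by (simp add: square_eq_choose_two mult_2 flip: power2_eq_square)
    then have "q ^ (j choose 2) * q ^ (i * j) * q ^ j * q ^ (4 * (m choose 2) + 3 * m)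
        = q ^ E"
      unfolding E_def i choose_two_add by (simp add: algebra_simps flip: power_add)
    moreover have "(- (w * q)) ^ j = (- w) ^ j * q ^ j"
      by (simp flip: power_mult_distrib)
    moreover have "(- (w ^ 2)) ^ m = (- w) ^ i * (- 1) ^ m"
      by (simp add: i power_mult flip: power_mult_distrib)
    moreover have "even i" "i div 2 = m"
      by (simp_all add: i)
    ultimately show ?thesis
      unfolding E_def[symmetric]
      by (simp add: \<beta>_def b_def euler_square_fps_def euler_inverse_fps_def euler_coeff_def
          power_add[of "- w"] field_simps)
  qed (simp add: \<beta>_def euler_square_fps_def)
  have "(\<Sum>i\<le>N. \<beta> i * (euler_coeff q (N - i) * (- (w * q)) ^ (N - i)) * q ^ (i * (N - i)))
      = q ^ (N ^ 2) / qpoch q q N * (- w) ^ N" for N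
  proof -
    have "(euler_square_fps q * euler_inverse_fps q 1) $ N = q ^ (N choose 2) / qpoch q q N"
      unfolding euler_square_fps_divide[OF q] by (simp add: euler_fps_def euler_coeff_def)
    moreover have "q ^ ((N choose 2) + N) * q ^ (N choose 2) = q ^ (N ^ 2)"
      by (simp add: square_eq_choose_two mult_2 add_ac flip: power_add)
    ultimately show ?thesis
      unfolding convolution_eq_fps_mult_nth[where C = "\<lambda>N. q ^ ((N choose 2) + N) * (- w) ^ N", OF coeff]
      by (simp add: mult_ac)
  qed
  from ramanujan_expansion[OF q \<beta> nz this]
  have "(\<lambda>i. \<beta> i / qpoch (w * q) q i) sums (ramanujan_A q w / qpoch_inf (w * q) q)" .
  then have "(\<lambda>m. \<beta> (2 * m) / qpoch (w * q) q (2 * m)) sums (ramanujan_A q w / qpoch_inf (w * q) q)"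
    by (subst sums_mono_reindex[OF reindex]) (auto simp: \<beta>_def elim!: evenE)
  moreover have "q ^ (3 * m ^ 2) = (q ^ 2) ^ (m choose 2) * q ^ (4 * (m choose 2) + 3 * m)" for m
    by (simp add: square_eq_choose_two flip: power_mult power_add)
  moreover have "qpoch (w * q) q (2 * m) = qpoch (w * q) (q ^ 2) m * qpoch (w * q ^ 2) (q ^ 2) m" for m
    by (simp add: qpoch_bisect power2_eq_square mult.assoc)
  ultimately show ?thesis
    by (simp add: \<beta>_def b_def euler_coeff_def mult_ac)
qed

lemma sums_divide_imp:
  fixes A P :: complex
  assumes "f sums (A / P)" and "P \<noteq> 0"
  shows "summable f \<and> A = P * suminf f"
  using assms by (auto simp: sums_iff field_simps)

lemma qpoch_nonzero_mono:
  assumes "qpoch a p n \<noteq> 0" and "m \<le> n"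
  shows "qpoch a p m \<noteq> 0"
  using assms by (auto simp: qpoch_def)

theorem theorem4p2:
  fixes q s a w :: complex and n :: nat
  assumes "0 < norm q" and "norm q < 1" and "s ^ 2 = q"
  shows
    "(\<lambda>k. q ^ ((k + 1) choose 2) * ramanujan_A q (a * q powi (int k - 2 * int n)) / qpoch q q k)
        sums (qpoch_inf (- q) q * qpoch_inf (a * q powi (1 - 2 * int n)) (q ^ 2))
     \<and>
     (\<lambda>k. q ^ (k choose 2) * (- (s ^ 3)) ^ k
            * ramanujan_A q (- (s powi (2 * int k - 2 * int n + 1))) / qpoch q q k)
        sums (qpoch q q n / (s ^ (n * (n - 1) div 2) * qpoch s s n))
     \<and>
     (\<lambda>k. s ^ (k ^ 2) * (- 1) ^ k
            * ramanujan_A q (- (s powi (2 * int k - 2 * int n - 1))) / qpoch q q k)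
        sums (qpoch q q n / (s ^ (n * (n + 1) div 2) * qpoch s s n))
     \<and>
     ((\<forall>m. qpoch (q ^ 2) (q ^ 2) m * qpoch (w * q) (q ^ 2) m * qpoch (w * q ^ 2) (q ^ 2) m \<noteq> 0) \<longrightarrow>
        summable (\<lambda>m. q ^ (3 * m ^ 2) * (- (w ^ 2)) ^ m /
          (qpoch (q ^ 2) (q ^ 2) m * qpoch (w * q) (q ^ 2) m * qpoch (w * q ^ 2) (q ^ 2) m)) \<and>
        ramanujan_A q w = qpoch_inf (w * q) q *
          (\<Sum>m. q ^ (3 * m ^ 2) * (- (w ^ 2)) ^ m /
            (qpoch (q ^ 2) (q ^ 2) m * qpoch (w * q) (q ^ 2) m * qpoch (w * q ^ 2) (q ^ 2) m)))
     \<and>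
     ((\<forall>m. qpoch s s m * qpoch (- (w * s)) q m \<noteq> 0) \<longrightarrow>
        summable (\<lambda>m. s ^ (m * (3 * m - 1) div 2) * (- w) ^ m /
          (qpoch s s m * qpoch (- (w * s)) q m)) \<and>
        ramanujan_A q w = qpoch_inf (- (w * s)) q *
          (\<Sum>m. s ^ (m * (3 * m - 1) div 2) * (- w) ^ m /
            (qpoch s s m * qpoch (- (w * s)) q m)))
     \<and>
     ((\<forall>m. qpoch s s m * qpoch (- (w * s ^ 3)) q m \<noteq> 0) \<longrightarrow>
        summable (\<lambda>m. s ^ (m * (3 * m + 1) div 2) * (- w) ^ m /
          (qpoch s s m * qpoch (- (w * s ^ 3)) q m)) \<and>
        ramanujan_A q w = qpoch_inf (- (w * s ^ 3)) q *
          (\<Sum>m. s ^ (m * (3 * m + 1) div 2) * (- w) ^ m /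
            (qpoch s s m * qpoch (- (w * s ^ 3)) q m)))"
proof -
  have s0: "s \<noteq> 0"
    using assms by auto
  have "norm s ^ 2 < 1"
    using assms by (simp flip: norm_power)
  then have s: "norm s < 1"
    by (simp add: power_less_one_iff)
  show ?thesis
  proof (rule conjI[OF _ conjI[OF _ conjI[OF _ conjI[OF impI conjI[OF impI impI]]]]], goal_cases)
    case 1
    show ?case
      using series_at_even_shifts assms by simp
  next
    case 2
    show ?case
      using series_at_odd_powers_above[OF s0 s] unfolding assms(3) .
  next
    case 3
    show ?case
      using series_at_odd_powers_below[OF s0 s] unfolding assms(3) .
  next
    case 4
    \<comment> \<open>The factors in base \<open>q ^ 2\<close> interlace, which covers every factor of the product in base \<open>q\<close>.\<close>
    then have nz: "qpoch (w * q) q i \<noteq> 0" for i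
      by (intro qpoch_nonzero_mono[of _ _ "2 * i" i])
        (auto simp: qpoch_bisect power2_eq_square mult.assoc)
    show ?case
      by (rule sums_divide_imp[OF expansion_base_square[OF assms(2) nz]
            qpoch_inf_nonzero[OF assms(2) nz]])
  next
    case 5
    then have nz: "qpoch (- (w * s)) q i \<noteq> 0" for i
      by auto
    show ?case
      by (rule sums_divide_imp[OF expansion_minus_half[OF s, unfolded assms(3), OF nz]
            qpoch_inf_nonzero[OF assms(2) nz]])
  next
    case 6
    then have nz: "qpoch (- (w * s ^ 3)) q i \<noteq> 0" for i
      by auto
    show ?case
      by (rule sums_divide_imp[OF expansion_minus_three_halves[OF s, unfolded assms(3), OF nz]
            qpoch_inf_nonzero[OF assms(2) nz]])
  qed
qed

end
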